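(* For a commutative semigroup $X$ the semigroup $\lambda(X)$ is linear if and only if $X$ is a linear semilattice of order $|X|\le 3$.
   Context: A semigroup $S$ is linear if $xy\in\{x,y\}$ for all $x,y\in S$. A semilattice is a commutative semigroup with $xx=x$ for all $x$. For a set $X$, an upfamily on $X$ is a non-empty family $\mathcal F$ of non-empty subsets of $X$ such that $A\in\mathcal F$ and $A\subset B\subset X$ imply $B\in\mathcal F$. For a family $\mathcal B$ of subsets of $X$, $\langle\mathcal B\rangle=\{A\subset X:\exists B\in\mathcal B,\ B\subset A\}$. An upfamily $\mathcal A$ is linked if $A\cap B\neq\emptyset$ for all $A,B\in\mathcal A$; maximal linked if it is linked and is not properly contained in another linked upfamily. $\lambda(X)$ is the set of all maximal linked upfamilies on $X$. If $X$ is a semigroup, $\lambda(X)$ is a semigroup under the operation $\mathcal U*\mathcal V=\big\langle\bigcup_{x\in U}xV_x: U\in\mathcal U,\ (V_x)_{x\in U}\in\mathcal V^U\big\rangle$. *)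

theory Defs
  imports Main
begin

(* Semigroups are given by a carrier set and an operation, so that the same
   predicates apply to a semigroup X and to the semigroup lambda(X). *)

definition semigroup_on :: "'a set \<Rightarrow> ('a \<Rightarrow> 'a \<Rightarrow> 'a) \<Rightarrow> bool" where
  "semigroup_on S f \<longleftrightarrow>
     (\<forall>x\<in>S. \<forall>y\<in>S. f x y \<in> S) \<and>
     (\<forall>x\<in>S. \<forall>y\<in>S. \<forall>z\<in>S. f (f x y) z = f x (f y z))"

definition comm_semigroup_on :: "'a set \<Rightarrow> ('a \<Rightarrow> 'a \<Rightarrow> 'a) \<Rightarrow> bool" where
  "comm_semigroup_on S f \<longleftrightarrow>
     semigroup_on S f \<and> (\<forall>x\<in>S. \<forall>y\<in>S. f x y = f y x)"

definition semilattice_on :: "'a set \<Rightarrow> ('a \<Rightarrow> 'a \<Rightarrow> 'a) \<Rightarrow> bool" where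
  "semilattice_on S f \<longleftrightarrow> comm_semigroup_on S f \<and> (\<forall>x\<in>S. f x x = x)"

definition linear_semigroup_on :: "'a set \<Rightarrow> ('a \<Rightarrow> 'a \<Rightarrow> 'a) \<Rightarrow> bool" where
  "linear_semigroup_on S f \<longleftrightarrow>
     semigroup_on S f \<and> (\<forall>x\<in>S. \<forall>y\<in>S. f x y \<in> {x, y})"

definition upfamily_on :: "'a set \<Rightarrow> 'a set set \<Rightarrow> bool" where
  "upfamily_on X \<F> \<longleftrightarrow>
     \<F> \<noteq> {} \<and> (\<forall>A\<in>\<F>. A \<subseteq> X \<and> A \<noteq> {}) \<and>
     (\<forall>A\<in>\<F>. \<forall>B. A \<subseteq> B \<and> B \<subseteq> X \<longrightarrow> B \<in> \<F>)"

definition linked :: "'a set set \<Rightarrow> bool" where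
  "linked \<A> \<longleftrightarrow> (\<forall>A\<in>\<A>. \<forall>B\<in>\<A>. A \<inter> B \<noteq> {})"

definition maximal_linked_on :: "'a set \<Rightarrow> 'a set set \<Rightarrow> bool" where
  "maximal_linked_on X \<A> \<longleftrightarrow>
     upfamily_on X \<A> \<and> linked \<A> \<and>
     \<not> (\<exists>\<B>. upfamily_on X \<B> \<and> linked \<B> \<and> \<A> \<subset> \<B>)"

definition superextension :: "'a set \<Rightarrow> 'a set set set" where
  "superextension X = {\<A>. maximal_linked_on X \<A>}"

definition up_closure_on :: "'a set \<Rightarrow> 'a set set \<Rightarrow> 'a set set" where
  "up_closure_on X \<B> = {A. A \<subseteq> X \<and> (\<exists>B\<in>\<B>. B \<subseteq> A)}"

(* A family (V_x), x in U, of members of \<V> is a function V on the whole type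
   of which only the values at points of U matter. *)

definition superextension_mult ::
    "'a set \<Rightarrow> ('a \<Rightarrow> 'a \<Rightarrow> 'a) \<Rightarrow> 'a set set \<Rightarrow> 'a set set \<Rightarrow> 'a set set" where
  "superextension_mult X f \<U> \<V> =
     up_closure_on X {(\<Union>x\<in>U. f x ` V x) |U V. U \<in> \<U> \<and> (\<forall>x\<in>U. V x \<in> \<V>)}"

(* The remaining facts end in semigroup_on_superextension: lambda(X) is a
   semigroup whenever X is, so the semigroup_on conjunct in linear_semigroup_on
   imposes nothing extra on lambda(X). *)

lemma upfamily_onD:
  assumes "upfamily_on X \<F>"
  shows "A \<in> \<F> \<Longrightarrow> A \<subseteq> X" and "A \<in> \<F> \<Longrightarrow> A \<noteq> {}"
    and "A \<in> \<F> \<Longrightarrow> A \<subseteq> B \<Longrightarrow> B \<subseteq> X \<Longrightarrow> B \<in> \<F>"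
proof -
  note D = assms[unfolded upfamily_on_def, THEN conjunct2]
  note 1 = conjunct1[OF D] and 2 = conjunct2[OF D]
  show "A \<in> \<F> \<Longrightarrow> A \<subseteq> X" by (rule conjunct1[OF bspec[OF 1]])
  show "A \<in> \<F> \<Longrightarrow> A \<noteq> {}" by (rule conjunct2[OF bspec[OF 1]])
  show "A \<in> \<F> \<Longrightarrow> A \<subseteq> B \<Longrightarrow> B \<subseteq> X \<Longrightarrow> B \<in> \<F>"
    by (rule 2[THEN bspec, THEN spec, THEN mp, OF _ conjI])
qed

lemma upfamily_on_carrier: "upfamily_on X \<F> \<Longrightarrow> X \<in> \<F>"
  unfolding upfamily_on_def by (metis equals0I order_refl)

lemma superextension_mult_mem_iff:
  assumes X: "semigroup_on X f" and U: "upfamily_on X \<U>" and V: "upfamily_on X \<V>"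
  shows "A \<in> superextension_mult X f \<U> \<V> \<longleftrightarrow>
           A \<subseteq> X \<and> {x\<in>X. {y\<in>X. f x y \<in> A} \<in> \<V>} \<in> \<U>"
proof
  assume "A \<in> superextension_mult X f \<U> \<V>"
  then obtain W V' where A: "A \<subseteq> X" and W: "W \<in> \<U>" and V': "\<forall>x\<in>W. V' x \<in> \<V>"
    and sub: "(\<Union>x\<in>W. f x ` V' x) \<subseteq> A"
    unfolding superextension_mult_def up_closure_on_def by auto
  have "W \<subseteq> X" by (rule upfamily_onD(1)[OF U W])
  have "{y\<in>X. f x y \<in> A} \<in> \<V>" if "x \<in> W" for x
  proof -
    have "V' x \<in> \<V>" "V' x \<subseteq> X" using V' that upfamily_onD(1)[OF V] by simp_all
    moreover have "V' x \<subseteq> {y\<in>X. f x y \<in> A}" using calculation sub that by blast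
    ultimately show ?thesis using upfamily_onD(3)[OF V] by blast
  qed
  with \<open>W \<subseteq> X\<close> have "W \<subseteq> {x\<in>X. {y\<in>X. f x y \<in> A} \<in> \<V>}" by blast
  moreover have "{x\<in>X. {y\<in>X. f x y \<in> A} \<in> \<V>} \<subseteq> X" by blast
  ultimately show "A \<subseteq> X \<and> {x\<in>X. {y\<in>X. f x y \<in> A} \<in> \<V>} \<in> \<U>"
    using A upfamily_onD(3)[OF U W] by blast
next
  assume *: "A \<subseteq> X \<and> {x\<in>X. {y\<in>X. f x y \<in> A} \<in> \<V>} \<in> \<U>"
  define W where "W = {x\<in>X. {y\<in>X. f x y \<in> A} \<in> \<V>}"
  define V' where "V' x = {y\<in>X. f x y \<in> A}" for x
  have "(\<Union>x\<in>W. f x ` V' x) \<subseteq> A" unfolding V'_def by blast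
  moreover have "W \<in> \<U>" "\<forall>x\<in>W. V' x \<in> \<V>" "A \<subseteq> X"
    using * unfolding W_def V'_def by simp_all
  ultimately show "A \<in> superextension_mult X f \<U> \<V>"
    unfolding superextension_mult_def up_closure_on_def by blast
qed

lemma maximal_linked_on_iff:
  "maximal_linked_on X \<A> \<longleftrightarrow>
     upfamily_on X \<A> \<and> linked \<A> \<and> (\<forall>A. A \<subseteq> X \<longrightarrow> A \<in> \<A> \<or> X - A \<in> \<A>)"
proof
  assume m: "maximal_linked_on X \<A>"
  then have u: "upfamily_on X \<A>" and l: "linked \<A>"
    unfolding maximal_linked_on_def by blast+
  have "A \<in> \<A> \<or> X - A \<in> \<A>" if AX: "A \<subseteq> X" for A
  proof (rule ccontr)
    assume n: "\<not> (A \<in> \<A> \<or> X - A \<in> \<A>)"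
    have meet: "A \<inter> C \<noteq> {}" if "C \<in> \<A>" for C
    proof
      assume "A \<inter> C = {}"
      moreover have "C \<subseteq> X" using u that by (rule upfamily_onD(1))
      ultimately have "C \<subseteq> X - A" by blast
      then show False using n upfamily_onD(3)[OF u that] by blast
    qed
    have "A \<noteq> {}" using meet upfamily_on_carrier[OF u] by blast
    define \<B> where "\<B> = \<A> \<union> {B. A \<subseteq> B \<and> B \<subseteq> X}"
    have "upfamily_on X \<B>"
      unfolding upfamily_on_def
    proof (intro conjI ballI allI impI)
      show "\<B> \<noteq> {}" using AX unfolding \<B>_def by blast
    next
      fix C assume "C \<in> \<B>"
      then consider "C \<in> \<A>" | "A \<subseteq> C" "C \<subseteq> X" unfolding \<B>_def by blast
      then have "C \<subseteq> X \<and> C \<noteq> {}"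
      proof cases
        case 1 then show ?thesis using upfamily_onD(1,2)[OF u] by simp
      next
        case 2 then show ?thesis using \<open>A \<noteq> {}\<close> by blast
      qed
      then show "C \<subseteq> X" "C \<noteq> {}" by simp_all
    next
      fix C D assume C: "C \<in> \<B>" and D: "C \<subseteq> D \<and> D \<subseteq> X"
      show "D \<in> \<B>"
      proof (cases "C \<in> \<A>")
        case True
        then have "D \<in> \<A>" using upfamily_onD(3)[OF u] D by blast
        then show ?thesis unfolding \<B>_def by simp
      next
        case False
        then show ?thesis using C D unfolding \<B>_def by auto
      qed
    qed
    moreover have "linked \<B>"
      unfolding linked_def
    proof (intro ballI)
      fix C D assume "C \<in> \<B>" "D \<in> \<B>"
      then consider "C \<in> \<A>" "D \<in> \<A>" | "C \<in> \<A>" "A \<subseteq> D" | "A \<subseteq> C" "D \<in> \<A>" | "A \<subseteq> C" "A \<subseteq> D"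
        unfolding \<B>_def by blast
      then show "C \<inter> D \<noteq> {}"
      proof cases
        case 1 then show ?thesis using l unfolding linked_def by blast
      next
        case 2 then show ?thesis using meet[of C] by blast
      next
        case 3 then show ?thesis using meet[of D] by blast
      next
        case 4 then show ?thesis using \<open>A \<noteq> {}\<close> by blast
      qed
    qed
    moreover have "\<A> \<subset> \<B>" using n AX unfolding \<B>_def by blast
    ultimately show False using m unfolding maximal_linked_on_def by blast
  qed
  with u l show "upfamily_on X \<A> \<and> linked \<A> \<and> (\<forall>A. A \<subseteq> X \<longrightarrow> A \<in> \<A> \<or> X - A \<in> \<A>)"
    by blast
next
  assume r: "upfamily_on X \<A> \<and> linked \<A> \<and> (\<forall>A. A \<subseteq> X \<longrightarrow> A \<in> \<A> \<or> X - A \<in> \<A>)"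
  have False if B: "upfamily_on X \<B>" "linked \<B>" "\<A> \<subset> \<B>" for \<B>
  proof -
    obtain A where A: "A \<in> \<B>" "A \<notin> \<A>" using B by blast
    then have "A \<subseteq> X" using upfamily_onD(1)[OF B(1)] by blast
    then have "X - A \<in> \<B>" using r A B by blast
    then have "A \<inter> (X - A) \<noteq> {}" using A B unfolding linked_def by blast
    then show False by blast
  qed
  with r show "maximal_linked_on X \<A>" unfolding maximal_linked_on_def by blast
qed

lemma superextensionD:
  assumes "\<A> \<in> superextension X"
  shows "upfamily_on X \<A>" and "linked \<A>" and "A \<subseteq> X \<Longrightarrow> A \<in> \<A> \<or> X - A \<in> \<A>"
proof -
  have *: "upfamily_on X \<A> \<and> linked \<A> \<and> (\<forall>A. A \<subseteq> X \<longrightarrow> A \<in> \<A> \<or> X - A \<in> \<A>)"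
    using assms unfolding superextension_def mem_Collect_eq maximal_linked_on_iff .
  show "upfamily_on X \<A>" by (rule conjunct1[OF *])
  show "linked \<A>" by (rule conjunct1[OF conjunct2[OF *]])
  show "A \<subseteq> X \<Longrightarrow> A \<in> \<A> \<or> X - A \<in> \<A>"
    by (rule conjunct2[OF conjunct2[OF *], rule_format])
qed

lemma superextension_mult_closed:
  assumes X: "semigroup_on X f" and U: "\<U> \<in> superextension X" and V: "\<V> \<in> superextension X"
  shows "superextension_mult X f \<U> \<V> \<in> superextension X"
proof -
  note u = superextensionD[OF U] and v = superextensionD[OF V]
  define D where "D A x = {y\<in>X. f x y \<in> A}" for A x
  define E where "E A = {x\<in>X. D A x \<in> \<V>}" for A
  let ?W = "superextension_mult X f \<U> \<V>"
  have mem: "A \<in> ?W \<longleftrightarrow> A \<subseteq> X \<and> E A \<in> \<U>" for A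
    unfolding E_def D_def by (rule superextension_mult_mem_iff[OF X u(1) v(1)])
  have up_U: "B \<in> \<U>" if "A \<in> \<U>" "A \<subseteq> B" "B \<subseteq> X" for A B
    using u(1) that by (rule upfamily_onD(3))
  have up_V: "B \<in> \<V>" if "A \<in> \<V>" "A \<subseteq> B" "B \<subseteq> X" for A B
    using v(1) that by (rule upfamily_onD(3))
  have XU: "X \<in> \<U>" and XV: "X \<in> \<V>"
    using u(1) v(1) by (simp_all add: upfamily_on_carrier)
  have DX: "D A x \<subseteq> X" and EX: "E A \<subseteq> X" for A x unfolding D_def E_def by blast+
  have lk: "A \<inter> B \<noteq> {}" if A: "A \<in> ?W" and B: "B \<in> ?W" for A B
  proof -
    have "E A \<inter> E B \<noteq> {}" using A B u(2) unfolding linked_def mem by simp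
    then obtain x where "D A x \<in> \<V>" "D B x \<in> \<V>" unfolding E_def by blast
    then have "D A x \<inter> D B x \<noteq> {}" using v(2) unfolding linked_def by blast
    then show ?thesis unfolding D_def by blast
  qed
  have "D X x = X" if "x \<in> X" for x
    using X that unfolding D_def semigroup_on_def by blast
  then have "E X = X" using XV unfolding E_def by (simp cong: conj_cong)
  then have "X \<in> ?W" using mem XU by simp
  have mono: "B \<in> ?W" if "A \<in> ?W" "A \<subseteq> B" "B \<subseteq> X" for A B
  proof -
    have "E A \<subseteq> E B"
    proof
      fix x assume "x \<in> E A"
      then have "x \<in> X" "D A x \<in> \<V>" unfolding E_def by auto
      moreover have "D A x \<subseteq> D B x" using that unfolding D_def by blast
      ultimately show "x \<in> E B" using up_V[OF _ _ DX] unfolding E_def by simp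
    qed
    then show ?thesis using that(1,3) up_U[OF _ _ EX] unfolding mem by blast
  qed
  have "upfamily_on X ?W"
    unfolding upfamily_on_def
  proof (intro conjI ballI allI impI)
    show "?W \<noteq> {}" using \<open>X \<in> ?W\<close> by blast
    show "A \<subseteq> X" if "A \<in> ?W" for A using that mem by simp
    show "A \<noteq> {}" if "A \<in> ?W" for A using lk[OF that that] by blast
    show "B \<in> ?W" if "A \<in> ?W" "A \<subseteq> B \<and> B \<subseteq> X" for A B using mono that by simp
  qed
  moreover have "linked ?W" using lk unfolding linked_def by blast
  moreover have "A \<in> ?W \<or> X - A \<in> ?W" if "A \<subseteq> X" for A
  proof (cases "E A \<in> \<U>")
    case True then show ?thesis using mem that by blast
  next
    case False
    then have c: "X - E A \<in> \<U>" using u(3)[OF EX] by blast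
    have "X - E A \<subseteq> E (X - A)"
    proof
      fix x assume x: "x \<in> X - E A"
      then have "X - D A x \<in> \<V>" using v(3)[OF DX] unfolding E_def by blast
      moreover have "X - D A x = D (X - A) x"
        using x X unfolding D_def semigroup_on_def by blast
      ultimately show "x \<in> E (X - A)" using x unfolding E_def by auto
    qed
    then show ?thesis using mem up_U[OF c _ EX] by blast
  qed
  ultimately show ?thesis unfolding superextension_def maximal_linked_on_iff by blast
qed

lemma superextension_mult_assoc:
  assumes X: "semigroup_on X f" and U: "\<U> \<in> superextension X"
    and V: "\<V> \<in> superextension X" and W: "\<W> \<in> superextension X"
  shows "superextension_mult X f (superextension_mult X f \<U> \<V>) \<W> =
         superextension_mult X f \<U> (superextension_mult X f \<V> \<W>)"
proof (rule set_eqI)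
  fix A
  have up: "upfamily_on X \<A>" if "\<A> \<in> superextension X" for \<A>
    using that unfolding superextension_def maximal_linked_on_def by blast
  note mem = superextension_mult_mem_iff[OF X]
  note UV = superextension_mult_closed[OF X U V] and VW = superextension_mult_closed[OF X V W]
  let ?E = "{z\<in>X. {y\<in>X. f z y \<in> A} \<in> \<W>}"
  have "{x\<in>X. {y\<in>X. f x y \<in> ?E} \<in> \<V>} =
        {x\<in>X. {y\<in>X. f x y \<in> A} \<in> superextension_mult X f \<V> \<W>}"
  proof (intro Collect_cong conj_cong refl)
    fix x assume x: "x \<in> X"
    have "{y\<in>X. f x y \<in> ?E} = {y\<in>X. {z\<in>X. f y z \<in> {y\<in>X. f x y \<in> A}} \<in> \<W>}"
    proof (intro Collect_cong conj_cong refl)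
      fix y assume y: "y \<in> X"
      have "{z\<in>X. f (f x y) z \<in> A} = {z\<in>X. f y z \<in> {y\<in>X. f x y \<in> A}}"
        using X x y unfolding semigroup_on_def by auto
      moreover have "f x y \<in> X" using X x y unfolding semigroup_on_def by blast
      ultimately show "f x y \<in> ?E \<longleftrightarrow> {z\<in>X. f y z \<in> {y\<in>X. f x y \<in> A}} \<in> \<W>" by simp
    qed
    then show "{y\<in>X. f x y \<in> ?E} \<in> \<V> \<longleftrightarrow>
        {y\<in>X. f x y \<in> A} \<in> superextension_mult X f \<V> \<W>"
      unfolding mem[OF up[OF V] up[OF W]] by auto
  qed
  then show "A \<in> superextension_mult X f (superextension_mult X f \<U> \<V>) \<W> \<longleftrightarrow>
        A \<in> superextension_mult X f \<U> (superextension_mult X f \<V> \<W>)"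
    unfolding mem[OF up[OF UV] up[OF W]] mem[OF up[OF U] up[OF VW]] mem[OF up[OF U] up[OF V]]
    by auto
qed

lemma semigroup_on_superextension:
  assumes "semigroup_on X f"
  shows "semigroup_on (superextension X) (superextension_mult X f)"
  using superextension_mult_closed[OF assms] superextension_mult_assoc[OF assms]
  unfolding semigroup_on_def by blast

end

theory Submission
  imports Defs
begin

text \<open>
  A maximal linked upfamily on \<open>X\<close> is a monotone self-dual Boolean function of the membership bits
  of a set \<open>A\<close>, and the product \<open>\<U> * \<V>\<close> decides \<open>A\<close> by evaluating \<open>\<U>\<close> on the bits
  ``\<open>\<V>\<close> accepts \<open>{y. x y \<in> A}\<close>'', one for each \<open>x\<close>. Two kinds of upfamily suffice here: the
  two-out-of-three majority of points \<open>a, b, c\<close> (which is the principal ultrafilter at \<open>a\<close> when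
  the three points coincide), and the star at \<open>a\<close> over \<open>b, c, d\<close>, a weighted majority in which
  \<open>a\<close> has two votes and the other points one each.

  If \<open>\<lambda>(X)\<close> is linear, multiplying principal ultrafilters shows that \<open>X\<close> is linear, and a linear
  commutative semigroup is a chain with \<open>x y = min x y\<close>. On four points \<open>a < b < c < d\<close>
  the majority of \<open>b, c, d\<close> multiplied by the star at \<open>a\<close> is a family that contains both
  \<open>{a, b}\<close> and \<open>{b, c}\<close>; the first set is not in the left factor and the second is not in
  the right one, so \<open>X\<close> has at most three points
  (\<open>card_le_3_if_superextension_linear\<close>).

  Conversely, on a set of at most three points every maximal linked upfamily is a principal
  ultrafilter or the majority of the three points (\<open>superextension_three\<close>). On a chain
  \<open>a \<le> b \<le> c\<close> write \<open>m\<close> for the majority of \<open>a, b, c\<close>; then \<open>m\<close> lies between \<open>b\<close> and \<open>c\<close>: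
  \<open>a m = a\<close>, \<open>b m = b\<close>, \<open>c m = m\<close> and \<open>m m = m\<close>. Hence \<open>\<lambda>(X)\<close> is a chain as well.
\<close>

section \<open>Majorities and stars\<close>

definition majority_on :: "'a set \<Rightarrow> 'a \<Rightarrow> 'a \<Rightarrow> 'a \<Rightarrow> 'a set set" where
  "majority_on X a b c =
     {A. A \<subseteq> X \<and> (a \<in> A \<and> b \<in> A \<or> a \<in> A \<and> c \<in> A \<or> b \<in> A \<and> c \<in> A)}"

definition star_on :: "'a set \<Rightarrow> 'a \<Rightarrow> 'a \<Rightarrow> 'a \<Rightarrow> 'a \<Rightarrow> 'a set set" where
  "star_on X a b c d =
     {A. A \<subseteq> X \<and> (a \<in> A \<and> (b \<in> A \<or> c \<in> A \<or> d \<in> A) \<or> b \<in> A \<and> c \<in> A \<and> d \<in> A)}"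

lemma majority_on_superextension:
  assumes "a \<in> X" "b \<in> X" "c \<in> X"
  shows "majority_on X a b c \<in> superextension X"
proof -
  have "X \<in> majority_on X a b c" using assms by (simp add: majority_on_def)
  then have "upfamily_on X (majority_on X a b c)"
    unfolding upfamily_on_def by (auto simp: majority_on_def)
  moreover have "linked (majority_on X a b c)"
    unfolding linked_def majority_on_def by blast
  moreover have "\<forall>A. A \<subseteq> X \<longrightarrow> A \<in> majority_on X a b c \<or> X - A \<in> majority_on X a b c"
    using assms unfolding majority_on_def by blast
  ultimately show ?thesis
    by (simp add: superextension_def maximal_linked_on_iff)
qed

lemma star_on_superextension:
  assumes "a \<in> X" "b \<in> X" "c \<in> X" "d \<in> X"
  shows "star_on X a b c d \<in> superextension X"
proof -
  have "X \<in> star_on X a b c d" using assms by (simp add: star_on_def)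
  then have "upfamily_on X (star_on X a b c d)"
    unfolding upfamily_on_def by (auto simp: star_on_def)
  moreover have "linked (star_on X a b c d)"
    unfolding linked_def star_on_def by blast
  moreover have "\<forall>A. A \<subseteq> X \<longrightarrow> A \<in> star_on X a b c d \<or> X - A \<in> star_on X a b c d"
    using assms unfolding star_on_def by blast
  ultimately show ?thesis
    by (simp add: superextension_def maximal_linked_on_iff)
qed

lemma mem_superextension_mult:
  assumes "semigroup_on X f" "\<U> \<in> superextension X" "\<V> \<in> superextension X"
  shows "A \<in> superextension_mult X f \<U> \<V> \<longleftrightarrow>
           A \<subseteq> X \<and> {x\<in>X. {y\<in>X. f x y \<in> A} \<in> \<V>} \<in> \<U>"
  using superextension_mult_mem_iff[OF assms(1) superextensionD(1)[OF assms(2)]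
      superextensionD(1)[OF assms(3)]] .

text \<open>
  The bit \<open>E x\<close> is the vote of the right factor on the translate \<open>{y. x y \<in> A}\<close>; only the bits at
  the three points of the left factor count.
\<close>
lemma superextension_mult_majority_on:
  assumes X: "semigroup_on X f"
    and u: "u \<in> X" "v \<in> X" "w \<in> X" and u': "u' \<in> X" "v' \<in> X" "w' \<in> X"
  shows "superextension_mult X f (majority_on X u v w) (majority_on X u' v' w') =
    {A. A \<subseteq> X \<and>
      (let E = (\<lambda>x. f x u' \<in> A \<and> f x v' \<in> A \<or> f x u' \<in> A \<and> f x w' \<in> A \<or>
                     f x v' \<in> A \<and> f x w' \<in> A)
       in E u \<and> E v \<or> E u \<and> E w \<or> E v \<and> E w)}"
  (is "?L = ?R")
proof (rule set_eqI)
  fix A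
  have "A \<in> ?L \<longleftrightarrow>
      A \<subseteq> X \<and> {x\<in>X. {y\<in>X. f x y \<in> A} \<in> majority_on X u' v' w'} \<in> majority_on X u v w"
    using mem_superextension_mult[OF X majority_on_superextension[OF u]
        majority_on_superextension[OF u']] .
  also have "\<dots> \<longleftrightarrow> A \<in> ?R"
    using u u' unfolding majority_on_def Let_def by simp
  finally show "A \<in> ?L \<longleftrightarrow> A \<in> ?R" .
qed

section \<open>Linear commutative semigroups as chains\<close>

text \<open>
  In the order \<open>x \<le> y \<longleftrightarrow> x y = x\<close> a finite set has a least element, namely the product of its
  elements; peeling it off repeatedly lists the set in increasing order.
\<close>
lemma linear_comm_imp_chain:
  assumes lin: "linear_semigroup_on X f" and com: "comm_semigroup_on X f"
    and S: "finite S" "S \<subseteq> X"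
  shows "\<exists>xs. set xs = S \<and> distinct xs \<and> sorted_wrt (\<lambda>x y. f x y = x) xs"
  using S
proof (induction "card S" arbitrary: S)
  case 0
  then show ?case by simp
next
  case (Suc n)
  have least: "\<exists>m\<in>T. \<forall>x\<in>T. f m x = m" if "finite T" "T \<noteq> {}" "T \<subseteq> X" for T
    using that
  proof (induction rule: finite_ne_induct)
    case (singleton x)
    then show ?case using lin unfolding linear_semigroup_on_def by auto
  next
    case (insert x T)
    then obtain m where m: "m \<in> T" "\<forall>y\<in>T. f m y = m" by auto
    have X: "x \<in> X" "m \<in> X" "\<forall>y\<in>T. y \<in> X" using insert m by auto
    (* The product of x with the least element of T is the least element of insert x T. *)
    let ?k = "f m x"
    have assoc: "f (f u v) w = f u (f v w)" if "u \<in> X" "v \<in> X" "w \<in> X" for u v w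
      using com that unfolding comm_semigroup_on_def semigroup_on_def by blast
    have comm: "f u v = f v u" if "u \<in> X" "v \<in> X" for u v
      using com that unfolding comm_semigroup_on_def by blast
    have idem: "f u u = u" if "u \<in> X" for u
      using lin that unfolding linear_semigroup_on_def by auto
    have "?k \<in> insert x T"
      using lin X m unfolding linear_semigroup_on_def by (metis insert_iff singletonD)
    moreover have "f ?k x = ?k" using X assoc idem by metis
    moreover have "f ?k y = ?k" if "y \<in> T" for y
      using X m assoc comm that by metis
    ultimately show ?case by blast
  qed
  have "S \<noteq> {}" using Suc.hyps(2) by auto
  then obtain m where m: "m \<in> S" "\<forall>x\<in>S. f m x = m"
    using least[OF Suc.prems(1) _ Suc.prems(2)] by blast
  have "n = card (S - {m})" using Suc.hyps(2) Suc.prems(1) m by simp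
  then obtain xs where xs: "set xs = S - {m}" "distinct xs"
      "sorted_wrt (\<lambda>x y. f x y = x) xs"
    using Suc.hyps(1)[of "S - {m}"] Suc.prems by blast
  have "set (m # xs) = S \<and> distinct (m # xs) \<and> sorted_wrt (\<lambda>x y. f x y = x) (m # xs)"
    using xs m by auto
  then show ?case by blast
qed

section \<open>Linearity of the superextension forces a chain of at most three points\<close>

text \<open>
  Since \<open>x \<mapsto> majority_on X x x x\<close> embeds \<open>X\<close> into \<open>\<lambda>(X)\<close>, the product \<open>x y\<close> is read off from
  the product of two principal ultrafilters.
\<close>
lemma linear_if_superextension_linear:
  assumes X: "semigroup_on X f"
    and lin: "linear_semigroup_on (superextension X) (superextension_mult X f)"
  shows "linear_semigroup_on X f"
proof -
  have "f x y \<in> {x, y}" if xy: "x \<in> X" "y \<in> X" for x y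
  proof -
    let ?P = "\<lambda>x. majority_on X x x x"
    have P: "?P z \<in> superextension X" if "z \<in> X" for z
      using that by (intro majority_on_superextension)
    have fxy: "f x y \<in> X" using X xy unfolding semigroup_on_def by blast
    have "{f x y} \<in> superextension_mult X f (?P x) (?P y)"
      using fxy xy
      by (subst mem_superextension_mult[OF X P P]) (auto simp: majority_on_def)
    moreover have "superextension_mult X f (?P x) (?P y) \<in> {?P x, ?P y}"
      using lin P xy unfolding linear_semigroup_on_def by blast
    ultimately have "{f x y} \<in> ?P x \<or> {f x y} \<in> ?P y" by auto
    then show ?thesis by (auto simp: majority_on_def)
  qed
  with X show ?thesis unfolding linear_semigroup_on_def by blast
qed

text \<open>
  On four points \<open>a < b < c < d\<close> the majority of \<open>b, c, d\<close> times the star at \<open>a\<close> is the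
  majority of \<open>a, b, c\<close>. The two sets \<open>{a, b}\<close> and \<open>{b, c}\<close> of the product separate it from the
  factors.
\<close>
lemma card_le_3_if_superextension_linear:
  assumes com: "comm_semigroup_on X f"
    and lin: "linear_semigroup_on (superextension X) (superextension_mult X f)"
  shows "finite X \<and> card X \<le> 3"
proof (rule ccontr)
  assume "\<not> (finite X \<and> card X \<le> 3)"
  then consider "infinite X" | "finite X" "4 \<le> card X" by linarith
  then obtain S where S: "S \<subseteq> X" "finite S" "card S = 4"
  proof cases
    case 1
    then show ?thesis using infinite_arbitrarily_large[of X 4] that by blast
  next
    case 2
    then show ?thesis using obtain_subset_with_card_n[of 4 X] that by blast
  qed
  have X: "semigroup_on X f" using com unfolding comm_semigroup_on_def by blast
  have linX: "linear_semigroup_on X f" by (rule linear_if_superextension_linear[OF X lin])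
  obtain xs where xs: "set xs = S" "distinct xs" "sorted_wrt (\<lambda>x y. f x y = x) xs"
    using linear_comm_imp_chain[OF linX com S(2,1)] by blast
  have "length xs = 4" using xs S distinct_card by metis
  then obtain a b c d where "xs = [a, b, c, d]"
    by (auto simp: numeral_eq_Suc length_Suc_conv)
  then have dist: "distinct [a, b, c, d]"
    and mem: "a \<in> X" "b \<in> X" "c \<in> X" "d \<in> X"
    and le: "f a b = a" "f a c = a" "f a d = a" "f b c = b" "f b d = b" "f c d = c"
    using xs S by auto
  have ge: "f b a = a" "f c a = a" "f d a = a" "f c b = b" "f d b = b" "f d c = c"
    using com mem le unfolding comm_semigroup_on_def by metis+
  have idem: "f a a = a" "f b b = b" "f c c = c" "f d d = d"
    using linX mem unfolding linear_semigroup_on_def by blast+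
  let ?U = "majority_on X b c d" and ?V = "star_on X a b c d"
  have U: "?U \<in> superextension X" and V: "?V \<in> superextension X"
    using mem by (simp_all add: majority_on_superextension star_on_superextension)
  note iff = mem_superextension_mult[OF X U V]
  have "{a, b} \<in> superextension_mult X f ?U ?V"
    unfolding iff using mem le ge idem by (auto simp: majority_on_def star_on_def)
  moreover have "{a, b} \<notin> ?U" using dist by (auto simp: majority_on_def)
  moreover have "{b, c} \<in> superextension_mult X f ?U ?V"
    unfolding iff using mem le ge idem by (auto simp: majority_on_def star_on_def)
  moreover have "{b, c} \<notin> ?V" using dist by (auto simp: star_on_def)
  moreover have "superextension_mult X f ?U ?V \<in> {?U, ?V}"
    using lin U V unfolding linear_semigroup_on_def by blast
  ultimately show False by auto
qed

section \<open>Chains of at most three points\<close>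

text \<open>
  If no singleton belongs to the family, all complements of singletons do, so the family
  contains every majority of the three points; a maximal linked family that contains another one
  equals it.
\<close>
lemma superextension_three:
  assumes X: "X = {a, b, c}" and U: "\<U> \<in> superextension X"
  shows "\<U> = majority_on X a a a \<or> \<U> = majority_on X b b b \<or> \<U> = majority_on X c c c \<or>
         \<U> = majority_on X a b c"
proof -
  note up = upfamily_onD[OF superextensionD(1)[OF U]]
  have maximal: "\<U> = majority_on X u v w"
    if "majority_on X u v w \<subseteq> \<U>" "u \<in> X" "v \<in> X" "w \<in> X" for u v w
    using that U majority_on_superextension[of u X v w]
    unfolding superextension_def maximal_linked_on_def by blast
  have principal: "\<U> = majority_on X x x x" if "{x} \<in> \<U>" for x
  proof (rule maximal)
    show "majority_on X x x x \<subseteq> \<U>"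
      using up(3)[OF that] by (auto simp: majority_on_def)
  qed (use up(1)[OF that] in simp_all)
  show ?thesis
  proof (cases "{a} \<in> \<U> \<or> {b} \<in> \<U> \<or> {c} \<in> \<U>")
    case True
    then show ?thesis using principal by auto
  next
    case False
    then have co: "X - {a} \<in> \<U>" "X - {b} \<in> \<U>" "X - {c} \<in> \<U>"
      using superextensionD(3)[OF U] X by blast+
    have "\<U> = majority_on X a b c"
    proof (rule maximal)
      show "majority_on X a b c \<subseteq> \<U>"
      proof
        fix A assume A: "A \<in> majority_on X a b c"
        then have "A \<subseteq> X" by (simp add: majority_on_def)
        moreover have "X - {a} \<subseteq> A \<or> X - {b} \<subseteq> A \<or> X - {c} \<subseteq> A"
          using A X by (auto simp: majority_on_def)
        ultimately show "A \<in> \<U>" using co up(3) by blast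
      qed
    qed (simp_all add: X)
    then show ?thesis by simp
  qed
qed

lemma superextension_linear_if_card_le_3:
  assumes lin: "linear_semigroup_on X f" and com: "comm_semigroup_on X f"
    and fin: "finite X" and card: "card X \<le> 3"
  shows "linear_semigroup_on (superextension X) (superextension_mult X f)"
proof (cases "X = {}")
  case True
  then have "superextension X = {}"
    using superextensionD(1) upfamily_onD(2) upfamily_on_carrier by blast
  then show ?thesis by (simp add: linear_semigroup_on_def semigroup_on_def)
next
  case False
  have X: "semigroup_on X f" using com unfolding comm_semigroup_on_def by blast
  obtain xs where xs: "set xs = X" "distinct xs" "sorted_wrt (\<lambda>x y. f x y = x) xs"
    using linear_comm_imp_chain[OF lin com fin] by blast
  have "length xs = card X" using xs distinct_card by metis
  then have "length xs = 1 \<or> length xs = 2 \<or> length xs = 3"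
    using card False fin card_0_eq[of X] by linarith
  then have "(\<exists>a. xs = [a]) \<or> (\<exists>a b. xs = [a, b]) \<or> (\<exists>a b c. xs = [a, b, c])"
    by (auto simp: numeral_eq_Suc length_Suc_conv)
  moreover have idem: "f x x = x" if "x \<in> X" for x
    using lin that unfolding linear_semigroup_on_def by blast
  (* A chain of fewer than three points is listed with its last point repeated. *)
  ultimately have "\<exists>a b c. X = {a, b, c} \<and> f a b = a \<and> f a c = a \<and> f b c = b"
  proof (elim disjE exE)
    fix a assume "xs = [a]"
    then have "X = {a, a, a}" "f a a = a" using xs idem by auto
    then show ?thesis by blast
  next
    fix a b assume "xs = [a, b]"
    then have "X = {a, b, b}" "f a b = a" "f b b = b" using xs idem by auto
    then show ?thesis by blast
  next
    fix a b c assume "xs = [a, b, c]"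
    then have "X = {a, b, c}" "f a b = a" "f a c = a" "f b c = b" using xs by auto
    then show ?thesis by blast
  qed
  then obtain a b c where abc: "X = {a, b, c}"
    and le: "f a b = a" "f a c = a" "f b c = b" by blast
  then have mem: "a \<in> X" "b \<in> X" "c \<in> X" by auto
  have ge: "f b a = a" "f c a = a" "f c b = b"
    using com mem le unfolding comm_semigroup_on_def by metis+
  have idem': "f a a = a" "f b b = b" "f c c = c" using idem mem by blast+
  have "superextension_mult X f \<U> \<V> \<in> {\<U>, \<V>}"
    if U: "\<U> \<in> superextension X" and V: "\<V> \<in> superextension X" for \<U> \<V>
  proof -
    let ?P = "\<lambda>x. majority_on X x x x" and ?M = "majority_on X a b c"
    have cases: "\<W> = ?P a \<or> \<W> = ?P b \<or> \<W> = ?P c \<or> \<W> = ?M"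
      if "\<W> \<in> superextension X" for \<W>
      using superextension_three[OF abc that] .
    (* Multiplication is the minimum for the order a, b, ?M, c. *)
    have table:
      "superextension_mult X f (?P a) (?P a) = ?P a"
      "superextension_mult X f (?P a) (?P b) = ?P a"
      "superextension_mult X f (?P a) (?P c) = ?P a"
      "superextension_mult X f (?P a) ?M = ?P a"
      "superextension_mult X f (?P b) (?P a) = ?P a"
      "superextension_mult X f (?P b) (?P b) = ?P b"
      "superextension_mult X f (?P b) (?P c) = ?P b"
      "superextension_mult X f (?P b) ?M = ?P b"
      "superextension_mult X f (?P c) (?P a) = ?P a"
      "superextension_mult X f (?P c) (?P b) = ?P b"
      "superextension_mult X f (?P c) (?P c) = ?P c"
      "superextension_mult X f (?P c) ?M = ?M"
      "superextension_mult X f ?M (?P a) = ?P a"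
      "superextension_mult X f ?M (?P b) = ?P b"
      "superextension_mult X f ?M (?P c) = ?M"
      "superextension_mult X f ?M ?M = ?M"
      using mem
      by (simp_all add: superextension_mult_majority_on[OF X] le ge idem' Let_def)
        (auto simp: majority_on_def)
    show ?thesis
      using cases[OF U] cases[OF V] by (elim disjE) (simp_all add: table)
  qed
  then show ?thesis
    using semigroup_on_superextension[OF X] unfolding linear_semigroup_on_def by blast
qed

theorem theorem4p3:
  fixes X :: "'a set" and f :: "'a \<Rightarrow> 'a \<Rightarrow> 'a"
  assumes "comm_semigroup_on X f"
  shows "linear_semigroup_on (superextension X) (superextension_mult X f) \<longleftrightarrow>
           linear_semigroup_on X f \<and> semilattice_on X f \<and> finite X \<and> card X \<le> 3"
proof
  assume lin: "linear_semigroup_on (superextension X) (superextension_mult X f)"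
  have "semigroup_on X f" using assms unfolding comm_semigroup_on_def by blast
  then have "linear_semigroup_on X f" using lin by (rule linear_if_superextension_linear)
  moreover from this have "semilattice_on X f"
    using assms unfolding semilattice_on_def linear_semigroup_on_def by blast
  ultimately show "linear_semigroup_on X f \<and> semilattice_on X f \<and> finite X \<and> card X \<le> 3"
    using card_le_3_if_superextension_linear[OF assms lin] by blast
next
  assume "linear_semigroup_on X f \<and> semilattice_on X f \<and> finite X \<and> card X \<le> 3"
  then show "linear_semigroup_on (superextension X) (superextension_mult X f)"
    using superextension_linear_if_card_le_3 assms by blast
qed

end
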